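(* Let $I\subset\mathbb{R}$ be a nontrivial interval and let $\mathcal{F}\subset\mathcal{C}^{1\#}(I)$. (i) If there exists $g\in\mathcal{CM}(I)$ such that $\mathscr{A}_f\le\mathscr{A}_g$ for all $f\in\mathcal{F}$, then there exists $u\in\mathcal{C}^{1\#}(I)$ such that (a) $\mathscr{A}_f\le\mathscr{A}_u$ for all $f\in\mathcal{F}$, and (b) $\mathscr{A}_u\le\mathscr{A}_k$ for every $k\in\mathcal{CM}(I)$ such that $\mathscr{A}_f\le\mathscr{A}_k$ for all $f\in\mathcal{F}$. (ii) If there exists $g\in\mathcal{CM}(I)$ such that $\mathscr{A}_f\ge\mathscr{A}_g$ for all $f\in\mathcal{F}$, then there exists $\ell\in\mathcal{C}^{1\#}(I)$ such that (a) $\mathscr{A}_f\ge\mathscr{A}_\ell$ for all $f\in\mathcal{F}$, and (b) $\mathscr{A}_\ell\ge\mathscr{A}_k$ for every $k\in\mathcal{CM}(I)$ such that $\mathscr{A}_f\ge\mathscr{A}_k$ for all $f\in\mathcal{F}$.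
   Context: $I$ denotes a nontrivial interval. $\mathcal{CM}(I)$ is the family of continuous, strictly monotone functions $f\colon I\to\mathbb{R}$. $\mathcal{C}^{1\#}(I)$ is the family of all $\mathcal{C}^1$ functions $I\to\mathbb{R}$ with nowhere vanishing first derivative (so $\mathcal{C}^{1\#}(I)\subset\mathcal{CM}(I)$). For $f\in\mathcal{CM}(I)$ the quasi-arithmetic mean $\mathscr{A}_f\colon\bigcup_{n=1}^\infty I^n\to I$ is defined by $$\mathscr{A}_f(v):=f^{-1}\left(\frac{f(v_1)+\cdots+f(v_n)}{n}\right)\qquad(n\in\mathbb{N},\ v\in I^n).$$ Inequalities between means, such as $\mathscr{A}_f\le\mathscr{A}_g$, are understood pointwise, i.e. $\mathscr{A}_f(v)\le\mathscr{A}_g(v)$ for all $v\in\bigcup_{n=1}^\infty I^n$.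
   Formalization: The family F is assumed nonempty (the claim fails for empty F), and membership in C^{1#}(I) means continuity on I with C^1 and nonvanishing derivative only in the interior of I, since with one-sided derivatives at end points belonging to I the claim is false. *)

theory Defs
  imports "HOL-Analysis.Analysis"
begin

definition nontrivial_interval :: "real set \<Rightarrow> bool" where
  "nontrivial_interval I \<longleftrightarrow> is_interval I \<and> (\<exists>a\<in>I. \<exists>b\<in>I. a < b)"

text \<open>Functions on \<open>I\<close> are represented by total functions; their values outside \<open>I\<close> are irrelevant.\<close>

definition CM :: "real set \<Rightarrow> (real \<Rightarrow> real) set" where
  "CM I = {f. continuous_on I f \<and> (strict_mono_on I f \<or> strict_antimono_on I f)}"

text \<open>
  The \<open>C\<^sup>1\<close> condition and the non-vanishing of the derivative are imposed at the interior points of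
  \<open>I\<close>; at an end point belonging to \<open>I\<close> only continuity is required. For open \<open>I\<close> this is the
  usual notion (lemma \<open>C1sharp_open\<close>).
  Requiring one-sided derivatives at end points, finite and nonzero, is not an option: on \<open>[0,1]\<close>
  let \<open>f\<^sub>n\<close> be the primitive of \<open>max t (1/n)\<close>. Every mean of an \<open>f\<^sub>n\<close> is bounded by that of \<open>x\<^sup>2\<close>,
  and on \<open>[1/n,1]\<close> the two means agree, so a least upper bound can only be generated by
  \<open>\<alpha> * x\<^sup>2 + \<beta>\<close>, whose derivative vanishes at \<open>0\<close>.
\<close>

definition C1sharp :: "real set \<Rightarrow> (real \<Rightarrow> real) set" where
  "C1sharp I = {f. continuous_on I f \<and> f C1_differentiable_on interior I \<and>
                   (\<forall>x\<in>interior I. deriv f x \<noteq> 0)}"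

lemma C1sharp_open:
  assumes "open I"
  shows "C1sharp I = {f. f C1_differentiable_on I \<and> (\<forall>x\<in>I. deriv f x \<noteq> 0)}"
  unfolding C1sharp_def interior_open[OF assms]
  by (blast intro: C1_differentiable_imp_continuous_on)

lemma C1sharp_subset_CM:
  assumes "nontrivial_interval I"
  shows "C1sharp I \<subseteq> CM I"
proof
  fix f assume f: "f \<in> C1sharp I"
  have int: "is_interval I" using assms by (simp add: nontrivial_interval_def)
  have cont: "continuous_on I f" using f by (simp add: C1sharp_def)
  obtain D where D: "\<And>x. x \<in> interior I \<Longrightarrow> (f has_real_derivative D x) (at x)"
    and contD: "continuous_on (interior I) D"
    using f unfolding C1sharp_def C1_differentiable_on_def
    by (auto simp: has_real_derivative_iff_has_vector_derivative)
  have nz: "D x \<noteq> 0" if "x \<in> interior I" for x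
    using f D[OF that] that by (auto simp: C1sharp_def dest: DERIV_imp_deriv)
  have conn: "connected (D ` interior I)"
    using int contD
    by (intro connected_continuous_image convex_connected convex_interior is_interval_convex)
  have sgn: "(\<forall>x\<in>interior I. D x > 0) \<or> (\<forall>x\<in>interior I. D x < 0)"
  proof (rule ccontr)
    assume "\<not> ?thesis"
    then obtain x y where xy: "x \<in> interior I" "y \<in> interior I" "D x < 0" "D y > 0"
      using nz by (metis linorder_neqE_linordered_idom)
    then have "0 \<in> D ` interior I"
      using connectedD_interval[OF conn, of "D x" "D y" 0] by auto
    then show False using nz by auto
  qed
  have sub: "{x..y} \<subseteq> I" "{x<..<y} \<subseteq> interior I" if "x \<in> I" "y \<in> I" for x y
  proof -
    show 1: "{x..y} \<subseteq> I" using int that unfolding is_interval_1 by (meson atLeastAtMost_iff subsetI)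
    have "{x<..<y} \<subseteq> I" by (rule order_trans[OF _ 1]) (simp add: greaterThanLessThan_subseteq_atLeastAtMost_iff)
    then show "{x<..<y} \<subseteq> interior I" by (rule interior_maximal) (rule open_greaterThanLessThan)
  qed
  have mvt: "\<exists>z\<in>interior I. f y - f x = (y - x) * D z" if xy: "x \<in> I" "y \<in> I" "x < y" for x y
  proof -
    have "continuous_on {x..y} f" using cont sub(1)[OF xy(1,2)] by (rule continuous_on_subset)
    moreover have "f differentiable (at z)" if "x < z" "z < y" for z
    proof -
      have "z \<in> interior I" using sub(2)[OF xy(1,2)] that by auto
      then show ?thesis using D by (auto simp: real_differentiable_def)
    qed
    ultimately obtain l z where "x < z" "z < y" "(f has_real_derivative l) (at z)" "f y - f x = (y - x) * l"
      using MVT[OF xy(3)] by blast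
    moreover from this have "z \<in> interior I" using sub(2)[OF xy(1,2)] by auto
    ultimately show ?thesis using D DERIV_unique by blast
  qed
  show "f \<in> CM I"
    using sgn
  proof
    assume pos: "\<forall>x\<in>interior I. D x > 0"
    have "f x < f y" if "x \<in> I" "y \<in> I" "x < y" for x y
      using mvt[OF that] pos that(3) by (metis diff_gt_0_iff_gt mult_pos_pos)
    then show ?thesis using cont by (auto simp: CM_def monotone_on_def)
  next
    assume neg: "\<forall>x\<in>interior I. D x < 0"
    have "f y < f x" if "x \<in> I" "y \<in> I" "x < y" for x y
      using mvt[OF that] neg that(3) by (metis diff_gt_0_iff_gt diff_less_0_iff_less mult_pos_neg)
    then show ?thesis using cont by (auto simp: CM_def monotone_on_def)
  qed
qed

text \<open>A vector in \<open>I\<^sup>n\<close>, \<open>n \<ge> 1\<close>, is a nonempty list with all entries in \<open>I\<close>.\<close>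

definition qa_mean :: "real set \<Rightarrow> (real \<Rightarrow> real) \<Rightarrow> real list \<Rightarrow> real" where
  "qa_mean I f v = inv_into I f ((\<Sum>x\<leftarrow>v. f x) / real (length v))"

definition qa_le :: "real set \<Rightarrow> (real \<Rightarrow> real) \<Rightarrow> (real \<Rightarrow> real) \<Rightarrow> bool" where
  "qa_le I f g \<longleftrightarrow> (\<forall>v. v \<noteq> [] \<and> set v \<subseteq> I \<longrightarrow> qa_mean I f v \<le> qa_mean I g v)"

end

theory Submission
  imports Defs
begin

text \<open>
  Normalise all functions to be increasing. Then \<open>\<A>\<^sub>f \<le> \<A>\<^sub>k\<close> means that \<open>k \<circ> f\<^sup>-\<^sup>1\<close> is convex; for a
  \<open>C\<^sup>1\<close> function \<open>f\<close> this says that \<open>k\<close> has a positive right derivative \<open>d\<close> in the interior and that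
  \<open>ln d - ln f'\<close> is nondecreasing. So the upper bounds of \<open>F\<close> correspond to the functions \<open>G\<close> whose
  increments dominate those of all \<open>ln f'\<close>, \<open>f \<in> F\<close>. Among these there is one, \<open>M\<close>, with least
  increments, and it is continuous although the \<open>G\<close> need not be. The least upper bound is an antiderivative
  \<open>u\<close> of \<open>exp M\<close>; at end points of \<open>I\<close> it has finite limits because its increments are dominated by
  multiples of those of some \<open>f \<in> F\<close> on the left and of the given upper bound on the right.
  Lower bounds are reduced to upper bounds by the reflection \<open>x \<mapsto> -x\<close>.
\<close>

subsection \<open>Right derivatives and monotonicity\<close>

lemma between_in_interior:
  fixes I :: "real set"
  assumes "is_interval I" "x \<in> I" "z \<in> I" "x < y" "y < z"
  shows "y \<in> interior I"
proof -
  have "{x<..<z} \<subseteq> I"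
    using assms(1-3) unfolding is_interval_1 by (meson greaterThanLessThan_iff less_imp_le subsetI)
  then have "{x<..<z} \<subseteq> interior I" by (simp add: interior_maximal)
  then show ?thesis using assms(4,5) by auto
qed

lemma open_real_neighbours:
  fixes S :: "real set"
  assumes "open S" "x \<in> S"
  obtains a b where "a < x" "x < b" "a \<in> S" "b \<in> S"
proof -
  obtain e where e: "e > 0" "cball x e \<subseteq> S" using assms open_contains_cball by blast
  then have "x - e \<in> S" "x + e \<in> S" by (auto simp: subset_iff dist_real_def)
  then show ?thesis using that[of "x - e" "x + e"] e(1) by auto
qed

text \<open>A substitute for the mean value theorem: a general upper bound \<open>k\<close> is only
  known to have right derivatives. If \<open>h\<close> rose, subtracting a small linear term would
  leave a function that still rises although all its right derivatives are negative; just after the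
  last point at or below an intermediate level it would have to dip below that level again.\<close>

lemma right_derivative_nonpos_imp_le:
  fixes h :: "real \<Rightarrow> real"
  assumes "a \<le> b" and cont: "continuous_on {a..b} h"
    and der: "\<And>x. a < x \<Longrightarrow> x < b \<Longrightarrow> \<exists>d\<le>0. (h has_real_derivative d) (at_right x)"
  shows "h b \<le> h a"
proof (rule ccontr)
  assume "\<not> h b \<le> h a"
  then have less: "h a < h b" by simp
  with \<open>a \<le> b\<close> have "a < b" by (cases "a = b") auto
  \<comment> \<open>Half of the mean slope of \<open>h\<close>, so that the tilted function
    \<open>g\<close> keeps half of the total rise.\<close>
  define e where "e = (h b - h a) / (2 * (b - a))"
  have "e > 0" using less \<open>a < b\<close> by (simp add: e_def)
  define g where "g t = h t - e * (t - a)" for t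
  have contg: "continuous_on {a..b} g"
    unfolding g_def by (intro continuous_intros cont)
  have ga: "g a = h a" by (simp add: g_def)
  have gb: "g b = (h a + h b) / 2" using \<open>a < b\<close> by (simp add: g_def e_def field_simps)
  define v where "v = (g a + g b) / 2"
  have v: "g a < v" "v < g b" using less by (auto simp: v_def ga gb field_simps)
  \<comment> \<open>Its maximum \<open>t\<close> satisfies \<open>g t = v\<close> by the
    intermediate value theorem, and \<open>t\<close> is neither \<open>a\<close> nor
    \<open>b\<close> because \<open>v\<close> lies strictly between \<open>g a\<close> and
    \<open>g b\<close>.\<close>
  define S where "S = {t \<in> {a..b}. g t \<le> v}"
  have "closed S" unfolding S_def
    by (rule continuous_on_closed_Collect_le) (use contg in \<open>auto intro: continuous_intros\<close>)
  moreover have "S \<subseteq> {a..b}" by (auto simp: S_def)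
  ultimately have "compact S" by (meson bounded_closed_interval bounded_subset compact_eq_bounded_closed)
  moreover have "a \<in> S" using \<open>a < b\<close> v by (simp add: S_def)
  ultimately obtain t where t: "t \<in> S" "\<And>s. s \<in> S \<Longrightarrow> s \<le> t"
    using compact_attains_sup[of S] by auto
  have tab: "a \<le> t" "t \<le> b" "g t \<le> v" using t(1) by (auto simp: S_def)
  obtain s where s: "t \<le> s" "s \<le> b" "g s = v"
    using IVT'[of g t v b] tab v continuous_on_subset[OF contg, of "{t..b}"] by fastforce
  then have "s \<in> S" using tab by (simp add: S_def)
  with s t have gt: "g t = v" by fastforce
  then have "a < t" "t < b" using v tab by (auto simp: order_less_le)
  then obtain d where d: "d \<le> 0" "(h has_real_derivative d) (at_right t)" using der by blast
  have "(g has_real_derivative d - e) (at_right t)"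
    unfolding g_def by (auto intro!: derivative_eq_intros d(2))
  moreover have "d - e < 0" using d(1) \<open>e > 0\<close> by simp
  ultimately obtain r where r: "r > 0" "\<And>y. y > 0 \<Longrightarrow> t + y \<in> {t<..} \<Longrightarrow> y < r \<Longrightarrow> g (t + y) < g t"
    using has_real_derivative_neg_dec_right by metis
  define y where "y = min r (b - t) / 2"
  have y: "y > 0" "y < r" "t + y \<le> b" using r(1) \<open>t < b\<close> by (auto simp: y_def min_def field_simps)
  then have "g (t + y) < v" using r(2)[of y] gt by auto
  then have "t + y \<in> S" using y tab by (simp add: S_def)
  then show False using t(2) y(1) by force
qed

subsection \<open>Least increments\<close>

text \<open>Given two competitors, splicing them at an intermediate point gives another one; this makes the
  infimum of the increments over all competitors additive. Continuity holds because a jump could be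
  removed from the least competitor.\<close>

lemma least_increments:
  fixes J :: "real set" and L :: "(real \<Rightarrow> real) set"
  assumes J: "open J" "J \<noteq> {}"
    and L: "L \<noteq> {}" "\<And>l. l \<in> L \<Longrightarrow> continuous_on J l"
    and G0: "\<And>l. l \<in> L \<Longrightarrow> mono_on J (\<lambda>x. G0 x - l x)"
  obtains M where "continuous_on J M"
    and "\<And>l. l \<in> L \<Longrightarrow> mono_on J (\<lambda>x. M x - l x)"
    and "\<And>G. (\<And>l. l \<in> L \<Longrightarrow> mono_on J (\<lambda>x. G x - l x)) \<Longrightarrow> mono_on J (\<lambda>x. G x - M x)"
proof -
  define GG where "GG = {G. \<forall>l\<in>L. mono_on J (\<lambda>x. G x - l x)}"
  have GGI: "G \<in> GG" if "\<And>l x y. l \<in> L \<Longrightarrow> x \<in> J \<Longrightarrow> y \<in> J \<Longrightarrow> x < y \<Longrightarrow> l y - l x \<le> G y - G x" for G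
    using that by (force simp: GG_def monotone_on_def order_le_less)
  have GGD: "l y - l x \<le> G y - G x" if "G \<in> GG" "l \<in> L" "x \<in> J" "y \<in> J" "x \<le> y" for G l x y
    using that by (force simp: GG_def monotone_on_def)
  have "G0 \<in> GG" using G0 by (auto simp: GG_def)
  obtain l0 where l0: "l0 \<in> L" using L(1) by auto
  obtain c where c: "c \<in> J" using J(2) by auto
  \<comment> \<open>For \<open>x \<le> y\<close> in \<open>J\<close> this infimum is finite: the
    increment of \<open>l0\<close> bounds every competitor from below, and \<open>G0\<close> is a
    competitor.\<close>
  define P where "P x y = (INF G\<in>GG. G y - G x)" for x y :: real
  have P_le: "P x y \<le> G y - G x" if "G \<in> GG" "x \<in> J" "y \<in> J" "x \<le> y" for G x y
    unfolding P_def
    by (rule cINF_lower[OF _ that(1)])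
       (use GGD[OF _ l0] that in \<open>auto intro!: bdd_belowI2[where m = "l0 y - l0 x"]\<close>)
  have P_ge: "a \<le> P x y" if "\<And>G. G \<in> GG \<Longrightarrow> a \<le> G y - G x" for a x y
    unfolding P_def by (rule cINF_greatest) (use \<open>G0 \<in> GG\<close> that in auto)
  have P_refl: "P x x = 0" for x
  proof -
    have "(\<lambda>G. G x - G x) ` GG = {0}" using \<open>G0 \<in> GG\<close> by auto
    then show ?thesis by (simp add: P_def)
  qed
  have P_add: "P x z = P x y + P y z" if "x \<in> J" "y \<in> J" "z \<in> J" "x \<le> y" "y \<le> z" for x y z
  proof (rule antisym)
    have split: "P x z \<le> (G1 y - G1 x) + (G2 z - G2 y)" if G: "G1 \<in> GG" "G2 \<in> GG" for G1 G2
    proof -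
      \<comment> \<open>The splice: \<open>G1\<close> up to \<open>y\<close>, then \<open>G2\<close>
        shifted to match at \<open>y\<close>. Its increment from \<open>x\<close> to
        \<open>z\<close> is the sum of the two partial increments, which yields subadditivity of the
        infimum.\<close>
      define G where "G t = (if t \<le> y then G1 t else G2 t - G2 y + G1 y)" for t
      have "G \<in> GG"
      proof (rule GGI)
        fix l s t assume st: "l \<in> L" "s \<in> J" "t \<in> J" "s < t"
        show "l t - l s \<le> G t - G s"
          using GGD[OF G(1) st(1) st(2,3)] GGD[OF G(1) st(1) st(2) \<open>y \<in> J\<close>]
            GGD[OF G(2) st(1) \<open>y \<in> J\<close> st(3)] GGD[OF G(2) st(1) st(2,3)] st(4)
          by (auto simp: G_def)
      qed
      then have "P x z \<le> G z - G x" using P_le that \<open>x \<in> J\<close> \<open>z \<in> J\<close> \<open>x \<le> y\<close> \<open>y \<le> z\<close> by auto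
      also have "\<dots> = (G1 y - G1 x) + (G2 z - G2 y)"
        using \<open>x \<le> y\<close> \<open>y \<le> z\<close> by (auto simp: G_def)
      finally show ?thesis .
    qed
    have "P x z - P x y \<le> P y z"
    proof (rule P_ge)
      fix G2 assume G2: "G2 \<in> GG"
      have "P x z - (G2 z - G2 y) \<le> P x y"
        by (rule P_ge) (use split[OF _ G2] in \<open>auto simp: algebra_simps\<close>)
      then show "P x z - P x y \<le> G2 z - G2 y" by simp
    qed
    then show "P x z \<le> P x y + P y z" by simp
    show "P x y + P y z \<le> P x z"
      by (rule P_ge) (use P_le[of _ x y] P_le[of _ y z] that in fastforce)
  qed
  \<comment> \<open>Normalised to vanish at \<open>c\<close>; additivity of \<open>P\<close> makes
    \<open>P x y\<close> the increment of \<open>M\<close> wherever \<open>x\<close> and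
    \<open>y\<close> lie relative to \<open>c\<close>.\<close>
  define M where "M y = (if c \<le> y then P c y else - P y c)" for y
  have M_diff: "M y - M x = P x y" if "x \<in> J" "y \<in> J" "x \<le> y" for x y
    using P_add[of c x y] P_add[of x c y] P_add[of x y c] that c P_refl
    by (auto simp: M_def)
  have M_GG: "M \<in> GG"
    by (rule GGI) (auto simp: M_diff intro!: P_ge GGD)
  have M_least: "M y - M x \<le> G y - G x" if "G \<in> GG" "x \<in> J" "y \<in> J" "x \<le> y" for G x y
    using P_le[OF that] M_diff that by simp
  \<comment> \<open>A nondecreasing function can be discontinuous only by jumping, and
    \<open>l0\<close> is continuous, so it suffices to exclude jumps of \<open>H\<close> on either
    side.\<close>
  define H where "H x = M x - l0 x" for x
  have H_mono: "H x \<le> H y" if "x \<in> J" "y \<in> J" "x \<le> y" for x y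
    using GGD[OF M_GG l0 that] by (simp add: H_def)
  have one_sided: "(l \<longlongrightarrow> l x) (at_right x)" "(l \<longlongrightarrow> l x) (at_left x)" if "l \<in> L" "x \<in> J" for l x
    using L(2)[OF that(1)] J(1) that(2)
    by (metis at_within_open continuous_on_def filterlim_at_split)+
  have right: "\<exists>y\<in>J. x < y \<and> H y < H x + e" if x: "x \<in> J" and "e > 0" for x e
  proof (rule ccontr)
    assume "\<not> ?thesis"
    then have jump: "H x + e \<le> H y" if "y \<in> J" "x < y" for y using that by (meson not_le)
    \<comment> \<open>Cutting a jump of height at least \<open>e\<close> out of \<open>M\<close>
      would give a competitor with a smaller increment across \<open>x\<close> than
      \<open>M\<close>.\<close>
    define G where "G t = (if t \<le> x then M t else M t - e)" for t
    have "G \<in> GG"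
    proof (rule GGI)
      fix l s t assume l: "l \<in> L" and st: "s \<in> J" "t \<in> J" "s < t"
      \<comment> \<open>For \<open>y\<close> between \<open>x\<close> and \<open>t\<close>,
        \<open>M t - l t\<close> is at least \<open>M y - l y\<close>, hence at least
        \<open>H x + e + l0 y - l y\<close>. Letting \<open>y\<close> decrease to \<open>x\<close>
        gives the claim, as \<open>l\<close> and \<open>l0\<close> are continuous.\<close>
      have key: "M x - l x \<le> M t - l t - e" if "x < t"
      proof -
        have "((\<lambda>y. M t - l t - (H x + e + l0 y - l y)) \<longlongrightarrow> M t - l t - (H x + e + l0 x - l x)) (at_right x)"
          by (intro tendsto_intros one_sided l l0 x)
        moreover have "eventually (\<lambda>y. y \<in> J) (at_right x)"
          using eventually_nhds_in_open[OF J(1) x] unfolding eventually_at_filter by (rule eventually_mono) simp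
        then have "eventually (\<lambda>y. 0 \<le> M t - l t - (H x + e + l0 y - l y)) (at_right x)"
          using eventually_at_right_real[OF that]
        proof eventually_elim
          case (elim y)
          then show ?case
            using jump[of y] GGD[OF M_GG l, of y t] st(2) by (auto simp: H_def)
        qed
        ultimately have "0 \<le> M t - l t - (H x + e + l0 x - l x)"
          by (rule tendsto_lowerbound) simp
        then show ?thesis by (simp add: H_def)
      qed
      show "l t - l s \<le> G t - G s"
        using key GGD[OF M_GG l st(1,2)] GGD[OF M_GG l st(1) x] st(3) by (auto simp: G_def)
    qed
    obtain y where "x < y" "y \<in> J" using open_real_neighbours[OF J(1) x] by blast
    then show False using M_least[OF \<open>G \<in> GG\<close> x, of y] \<open>e > 0\<close> by (simp add: G_def)
  qed
  have left: "\<exists>y\<in>J. y < x \<and> H x - e < H y" if x: "x \<in> J" and "e > 0" for x e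
  proof (rule ccontr)
    assume "\<not> ?thesis"
    then have jump: "H y \<le> H x - e" if "y \<in> J" "y < x" for y using that by (meson not_le)
    \<comment> \<open>Mirror image of the previous case: raising \<open>M\<close> to the left of
      \<open>x\<close> removes a jump on that side.\<close>
    define G where "G t = (if t < x then M t + e else M t)" for t
    have "G \<in> GG"
    proof (rule GGI)
      fix l s t assume l: "l \<in> L" and st: "s \<in> J" "t \<in> J" "s < t"
      have key: "M s - l s + e \<le> M x - l x" if "s < x"
      proof -
        have "((\<lambda>y. H x - e + l0 y - l y - (M s - l s)) \<longlongrightarrow> H x - e + l0 x - l x - (M s - l s)) (at_left x)"
          by (intro tendsto_intros one_sided l l0 x)
        moreover have "eventually (\<lambda>y. y \<in> J) (at_left x)"
          using eventually_nhds_in_open[OF J(1) x] unfolding eventually_at_filter by (rule eventually_mono) simp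
        then have "eventually (\<lambda>y. 0 \<le> H x - e + l0 y - l y - (M s - l s)) (at_left x)"
          using eventually_at_left_real[OF that]
        proof eventually_elim
          case (elim y)
          then show ?case
            using jump[of y] GGD[OF M_GG l, of s y] st(1) by (auto simp: H_def)
        qed
        ultimately have "0 \<le> H x - e + l0 x - l x - (M s - l s)"
          by (rule tendsto_lowerbound) simp
        then show ?thesis by (simp add: H_def)
      qed
      show "l t - l s \<le> G t - G s"
        using key GGD[OF M_GG l st(1,2)] GGD[OF M_GG l x st(2)] st(3) by (auto simp: G_def)
    qed
    obtain y where "y < x" "y \<in> J" using open_real_neighbours[OF J(1) x] by blast
    then show False using M_least[OF \<open>G \<in> GG\<close> _ x, of y] \<open>e > 0\<close> by (simp add: G_def)
  qed
  have "continuous_on J H"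
    unfolding continuous_on_def
  proof (intro ballI tendstoI)
    fix x e :: real assume x: "x \<in> J" and "e > 0"
    obtain y1 where y1: "y1 \<in> J" "x < y1" "H y1 < H x + e" using right[OF x \<open>e > 0\<close>] by auto
    obtain y2 where y2: "y2 \<in> J" "y2 < x" "H x - e < H y2" using left[OF x \<open>e > 0\<close>] by auto
    have "\<forall>\<^sub>F y in at x within J. y \<in> {y2<..<y1} \<inter> J"
      using x y1 y2 J(1) by (intro eventually_at_topological[THEN iffD2] exI[of _ "{y2<..<y1} \<inter> J"]) auto
    then show "\<forall>\<^sub>F y in at x within J. dist (H y) (H x) < e"
    proof eventually_elim
      case (elim y)
      then have "H y2 \<le> H y" "H y \<le> H y1" using H_mono y1 y2 by auto
      then show ?case using y1 y2 by (auto simp: dist_real_def)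
    qed
  qed
  then have "continuous_on J (\<lambda>x. H x + l0 x)" using L(2)[OF l0] by (intro continuous_intros)
  then have "continuous_on J M" by (simp add: H_def)
  moreover have "mono_on J (\<lambda>x. M x - l x)" if "l \<in> L" for l using M_GG that by (auto simp: GG_def)
  moreover have "mono_on J (\<lambda>x. G x - M x)" if "\<And>l. l \<in> L \<Longrightarrow> mono_on J (\<lambda>x. G x - l x)" for G
    using M_least[of G] that by (force simp: GG_def monotone_on_def)
  ultimately show ?thesis using that by blast
qed

subsection \<open>Comparison of quasi-arithmetic means\<close>

lemma qa_mean_eqI:
  assumes "inj_on f I" "m \<in> I" "f m = (\<Sum>x\<leftarrow>v. f x) / real (length v)"
  shows "qa_mean I f v = m"
  unfolding qa_mean_def assms(3)[symmetric] using assms(1,2) by (rule inv_into_f_f)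

text \<open>The image of an interval under a continuous function is convex, so the average of values
  of \<open>f\<close> is itself a value of \<open>f\<close>.\<close>

lemma qa_mean:
  assumes I: "is_interval I" and f: "continuous_on I f" and v: "v \<noteq> []" "set v \<subseteq> I"
  shows "qa_mean I f v \<in> I" "f (qa_mean I f v) = (\<Sum>x\<leftarrow>v. f x) / real (length v)"
proof -
  have "convex (f ` I)"
    using connected_continuous_image[OF f] I by (metis is_interval_connected_1 is_interval_convex_1)
  then have "(\<Sum>i<length v. (1 / real (length v)) *\<^sub>R f (v ! i)) \<in> f ` I"
    using v by (intro convex_sum) (auto simp: subset_iff)
  moreover have "(\<Sum>i<length v. (1 / real (length v)) *\<^sub>R f (v ! i)) = (\<Sum>x\<leftarrow>v. f x) / real (length v)"
    by (simp add: sum_list_sum_nth atLeast0LessThan flip: sum_divide_distrib)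
  ultimately have "(\<Sum>x\<leftarrow>v. f x) / real (length v) \<in> f ` I" by simp
  then show "qa_mean I f v \<in> I" "f (qa_mean I f v) = (\<Sum>x\<leftarrow>v. f x) / real (length v)"
    unfolding qa_mean_def by (auto intro: inv_into_into f_inv_into_f)
qed

lemma CM_inj_on: "f \<in> CM I \<Longrightarrow> inj_on f I"
  by (auto simp: CM_def monotone_on_def intro!: linorder_inj_onI) fastforce+

lemma qa_mean_uminus:
  assumes "is_interval I" "f \<in> CM I" "v \<noteq> []" "set v \<subseteq> I"
  shows "qa_mean I (\<lambda>x. - f x) v = qa_mean I f v"
proof (rule qa_mean_eqI)
  have "continuous_on I f" using assms(2) by (simp add: CM_def)
  note qa_mean[OF assms(1) this assms(3,4)]
  then show "qa_mean I f v \<in> I"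
    "- f (qa_mean I f v) = (\<Sum>x\<leftarrow>v. - f x) / real (length v)"
    by (simp_all add: uminus_sum_list_map[unfolded comp_def, symmetric])
  show "inj_on (\<lambda>x. - f x) I" using CM_inj_on[OF assms(2)] by (simp add: inj_on_def)
qed

text \<open>With \<open>m\<close> as the \<open>f\<close>-mean of \<open>v\<close>, applying the
  increasing \<open>k\<close> to the inequality of means gives Jensen's inequality for
  \<open>k o f^-1\<close> with equal weights, free of inverse functions and division.\<close>

lemma qa_le_iff_sum:
  assumes I: "is_interval I"
    and f: "continuous_on I f" "strict_mono_on I f"
    and k: "continuous_on I k" "strict_mono_on I k"
  shows "qa_le I f k \<longleftrightarrow> (\<forall>v m. v \<noteq> [] \<and> set v \<subseteq> I \<and> m \<in> I \<and> real (length v) * f m = (\<Sum>x\<leftarrow>v. f x)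
            \<longrightarrow> real (length v) * k m \<le> (\<Sum>x\<leftarrow>v. k x))"
proof -
  have inj: "inj_on f I" using f(2) by (simp add: strict_mono_on_imp_inj_on)
  have le: "qa_mean I f v \<le> qa_mean I k v \<longleftrightarrow> real (length v) * k (qa_mean I f v) \<le> (\<Sum>x\<leftarrow>v. k x)"
    if v: "v \<noteq> []" "set v \<subseteq> I" for v
  proof -
    have "qa_mean I f v \<le> qa_mean I k v \<longleftrightarrow> k (qa_mean I f v) \<le> k (qa_mean I k v)"
      using strict_mono_on_leD[OF k(2)] strict_mono_onD[OF k(2)] qa_mean(1)[OF I f(1) v] qa_mean(1)[OF I k(1) v]
      by (meson not_le)
    then show ?thesis using v by (simp add: qa_mean(2)[OF I k(1) v] field_simps)
  qed
  have eq: "m = qa_mean I f v \<longleftrightarrow> m \<in> I \<and> real (length v) * f m = (\<Sum>x\<leftarrow>v. f x)"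
    if v: "v \<noteq> []" "set v \<subseteq> I" for v m
    using qa_mean[OF I f(1) v] qa_mean_eqI[OF inj, of m v] v by (auto simp: field_simps)
  show ?thesis unfolding qa_le_def
  proof (intro iffI allI impI)
    fix v m
    assume *: "\<forall>v. v \<noteq> [] \<and> set v \<subseteq> I \<longrightarrow> qa_mean I f v \<le> qa_mean I k v"
      and v: "v \<noteq> [] \<and> set v \<subseteq> I \<and> m \<in> I \<and> real (length v) * f m = (\<Sum>x\<leftarrow>v. f x)"
    then have "m = qa_mean I f v" using eq by simp
    then show "real (length v) * k m \<le> (\<Sum>x\<leftarrow>v. k x)" using * v le by simp
  next
    fix v
    assume *: "\<forall>v m. v \<noteq> [] \<and> set v \<subseteq> I \<and> m \<in> I \<and> real (length v) * f m = (\<Sum>x\<leftarrow>v. f x)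
        \<longrightarrow> real (length v) * k m \<le> (\<Sum>x\<leftarrow>v. k x)"
      and v: "v \<noteq> [] \<and> set v \<subseteq> I"
    then have "qa_mean I f v \<in> I \<and> real (length v) * f (qa_mean I f v) = (\<Sum>x\<leftarrow>v. f x)"
      using eq by blast
    then show "qa_mean I f v \<le> qa_mean I k v" using * v le by blast
  qed
qed

text \<open>This is convexity of \<open>k o f^-1\<close> as an inequality of slopes, with
  denominators cleared. Lists with repeated entries realise rational weights only; if the inequality
  failed at \<open>y\<close>, continuity would make it fail at a nearby point whose weight is
  rational.\<close>

lemma qa_le_chord:
  assumes I: "is_interval I"
    and f: "continuous_on I f" "strict_mono_on I f"
    and k: "continuous_on I k" "strict_mono_on I k"
    and le: "qa_le I f k"
    and xyz: "x \<in> I" "z \<in> I" "x < y" "y < z"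
  shows "(k y - k x) * (f z - f y) \<le> (k z - k y) * (f y - f x)"
proof (rule ccontr)
  have sub: "{x..z} \<subseteq> I" using I xyz unfolding is_interval_1 by (meson atLeastAtMost_iff subsetI)
  have fxz: "f x < f z" using strict_mono_onD[OF f(2)] xyz by simp
  \<comment> \<open>\<open>q t\<close> is the weight of \<open>f z\<close> when \<open>f t\<close>
    is written as a combination of \<open>f x\<close> and \<open>f z\<close>; \<open>h t\<close>
    below is the height of \<open>k\<close> above the corresponding chord.\<close>
  define q where "q t = (f t - f x) / (f z - f x)" for t
  define h where "h t = k t - ((1 - q t) * k x + q t * k z)" for t
  assume "\<not> ?thesis"
  then have neg: "0 < h y" using fxz by (simp add: h_def q_def divide_simps) (simp add: algebra_simps)
  have conth: "continuous_on {x..z} h" and contq: "continuous_on {x..z} q"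
    unfolding h_def q_def using fxz f(1) k(1) sub
    by (auto intro!: continuous_intros intro: continuous_on_subset)
  have "open ({x<..<z} \<inter> h -` {0<..})"
    by (rule continuous_open_preimage) (use conth in \<open>auto intro: continuous_on_subset\<close>)
  moreover have "y \<in> {x<..<z} \<inter> h -` {0<..}" using neg xyz by auto
  ultimately obtain e where e: "e > 0" "cball y e \<subseteq> {x<..<z} \<inter> h -` {0<..}"
    using open_contains_cball by blast
  have cb: "{y..y+e} \<subseteq> {x<..<z} \<inter> h -` {0<..}"
    using e by (auto simp: subset_iff dist_real_def)
  have "y \<in> {x<..<z}" "y + e \<in> {x<..<z}" using subsetD[OF cb, of y] subsetD[OF cb, of "y + e"] e(1) by auto
  then have "y \<in> I" "y + e \<in> I" using sub by auto
  then have "f y < f (y + e)" using strict_mono_onD[OF f(2)] e(1) by simp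
  then have "q y < q (y + e)" using fxz by (simp add: q_def divide_strict_right_mono)
  \<comment> \<open>The intermediate value theorem turns this rational weight into a point
    \<open>t\<close> of \<open>{y..y+e}\<close>, where \<open>h\<close> is still positive.\<close>
  then obtain r where r: "q y < of_rat r" "of_rat r < q (y + e)" using of_rat_dense by blast
  have "continuous_on {y..y+e} q" 
    by (rule continuous_on_subset[OF contq]) (use \<open>y \<in> {x<..<z}\<close> \<open>y + e \<in> {x<..<z}\<close> in auto)
  then obtain t where t: "t \<in> {y..y+e}" "q t = of_rat r"
    using IVT'[of q y "of_rat r" "y + e"] r e(1) by auto
  have txz: "x < t" "t < z" "0 < h t" using cb t(1) by auto
  then have "t \<in> I" using sub by auto
  then have ft: "f x < f t" "f t < f z" using strict_mono_onD[OF f(2)] txz xyz by auto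
  then have q01: "0 < q t" "q t < 1" using fxz by (simp_all add: q_def)
  have "q t \<in> \<rat>" using t(2) by simp
  then obtain m n :: nat where n: "n \<noteq> 0" "\<bar>q t\<bar> = real m / real n" using Rats_abs_nat_div_natE by metis
  then have qt: "q t = real m / real n" using q01 by simp
  with q01 n(1) have mn: "0 < m" "m < n" by (auto simp: divide_simps)
  \<comment> \<open>The list realising the weight \<open>m / n\<close>: its \<open>f\<close>-mean is
    \<open>t\<close>, so the comparison of means puts \<open>k t\<close> at or below the
    chord.\<close>
  define v where "v = replicate (n - m) x @ replicate m z"
  have v: "v \<noteq> []" "set v \<subseteq> I" "length v = n" using mn xyz by (auto simp: v_def)
  have sum_v: "(\<Sum>s\<leftarrow>v. p s) = (real n - real m) * p x + real m * p z" for p :: "real \<Rightarrow> real"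
    using mn by (simp add: v_def sum_list_replicate of_nat_diff)
  have "q t * (f z - f x) = f t - f x" using fxz by (simp add: q_def)
  then have "f t = (1 - q t) * f x + q t * f z" by (simp add: algebra_simps)
  then have "real n * f t = (\<Sum>s\<leftarrow>v. f s)" unfolding sum_v qt using n(1) by (simp add: field_simps)
  then have "real n * k t \<le> (\<Sum>s\<leftarrow>v. k s)"
    using le[unfolded qa_le_iff_sum[OF I f k]] v \<open>t \<in> I\<close> by blast
  then have "k t \<le> (1 - q t) * k x + q t * k z"
    unfolding sum_v qt using n(1) by (simp add: field_simps)
  then show False using txz(3) by (simp add: h_def)
qed

section \<open>Comparison of means through right derivatives\<close>

lemma slope_tendsto_right:
  fixes f k :: "real \<Rightarrow> real"
  assumes "(f has_real_derivative e) (at_right y)" "e \<noteq> 0" "(k has_real_derivative d) (at_right y)"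
  shows "((\<lambda>w. (k w - k y) / (f w - f y)) \<longlongrightarrow> d / e) (at_right y)"
proof -
  have "((\<lambda>w. ((k w - k y) / (w - y)) / ((f w - f y) / (w - y))) \<longlongrightarrow> d / e) (at_right y)"
    using assms by (intro tendsto_divide) (auto simp: has_field_derivative_iff)
  moreover have "\<forall>\<^sub>F w in at_right y.
      ((k w - k y) / (w - y)) / ((f w - f y) / (w - y)) = (k w - k y) / (f w - f y)"
    by (auto simp: eventually_at_filter)
  ultimately show ?thesis by (rule Lim_transform_eventually)
qed

text \<open>The slopes \<open>R w\<close> of \<open>k\<close> relative to \<open>f\<close> over
  \<open>[y,w]\<close> decrease as \<open>w\<close> decreases to \<open>y\<close>, and the slope
  \<open>K > 0\<close> over \<open>[x,y]\<close> bounds them from below, both by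
  \<open>qa_le_chord\<close>. Hence they have a limit \<open>p \<ge> K\<close>, and
  \<open>p * e\<close> is the right derivative of \<open>k\<close>.\<close>

lemma qa_le_right_derivative_exists:
  assumes I: "is_interval I"
    and f: "continuous_on I f" "strict_mono_on I f"
    and k: "continuous_on I k" "strict_mono_on I k"
    and le: "qa_le I f k" and y: "y \<in> interior I"
    and e: "(f has_real_derivative e) (at_right y)" "e > 0"
  obtains d where "(k has_real_derivative d) (at_right y)" "d > 0"
proof -
  obtain x z where "x < y" "y < z" "x \<in> interior I" "z \<in> interior I"
    by (rule open_real_neighbours[OF open_interior y])
  then have xz: "x < y" "y < z" "x \<in> I" "z \<in> I" using interior_subset by auto
  have yI: "y \<in> I" using y interior_subset by blast
  define R where "R w = (k w - k y) / (f w - f y)" for w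
  have fpos: "f y < f w" if "w \<in> I" "y < w" for w using strict_mono_onD[OF f(2)] that yI by blast
  have "f x < f y" "k x < k y" using strict_mono_onD[OF f(2)] strict_mono_onD[OF k(2)] xz yI by auto
  define K where "K = (k y - k x) / (f y - f x)"
  have "K > 0" using \<open>f x < f y\<close> \<open>k x < k y\<close> by (simp add: K_def)
  have mono: "R a \<le> R b" if ab: "a \<in> I" "b \<in> I" "y < a" "a \<le> b" for a b
  proof (cases "a = b")
    case False
    then have "(k a - k y) * (f b - f a) \<le> (k b - k a) * (f a - f y)"
      using qa_le_chord[OF I f k le, of y b a] ab yI by auto
    then have "(k a - k y) * (f b - f y) \<le> (k b - k y) * (f a - f y)" by (simp add: algebra_simps)
    then show ?thesis using fpos ab by (simp add: R_def divide_simps)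
  qed simp
  have bound: "K \<le> R a" if "a \<in> I" "y < a" for a
    using qa_le_chord[OF I f k le xz(3) that(1) xz(1) that(2)] fpos[OF that] \<open>f x < f y\<close>
    by (simp add: R_def K_def divide_simps mult.commute)
  define p where "p = Inf (R ` ({y<..} \<inter> I))"
  have "K \<le> p" unfolding p_def by (rule cInf_greatest) (use bound xz in auto)
  have "(R \<longlongrightarrow> p) (at y within ({y<..} \<inter> I))"
    unfolding p_def by (rule Lim_right_bound[where K = K]) (use mono bound in auto)
  moreover have "at y within ({y<..} \<inter> I) = at_right y"
    using y by (intro at_within_nhd[where S = "interior I"]) (use interior_subset in auto)
  ultimately have "(R \<longlongrightarrow> p) (at_right y)" by simp
  then have "((\<lambda>w. R w * ((f w - f y) / (w - y))) \<longlongrightarrow> p * e) (at_right y)"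
    using e(1) by (intro tendsto_mult) (auto simp: has_field_derivative_iff)
  moreover have "\<forall>\<^sub>F w in at_right y. w < z"
    using xz(2) by (intro eventually_at_rightI[of y z]) auto
  then have "\<forall>\<^sub>F w in at_right y. R w * ((f w - f y) / (w - y)) = (k w - k y) / (w - y)"
    using eventually_at_right_less[of y]
  proof eventually_elim
    case (elim w)
    then have "w \<in> I" using I yI xz unfolding is_interval_1 by (meson less_imp_le)
    then show ?case using fpos[of w] elim by (simp add: R_def)
  qed
  ultimately have "((\<lambda>w. (k w - k y) / (w - y)) \<longlongrightarrow> p * e) (at_right y)"
    by (rule Lim_transform_eventually)
  then have "(k has_real_derivative p * e) (at_right y)" by (simp add: has_field_derivative_iff)
  moreover have "p * e > 0" using \<open>K > 0\<close> \<open>K \<le> p\<close> e(2) by simp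
  ultimately show ?thesis using that by blast
qed

text \<open>The ratio is the right derivative of the convex function \<open>k o f^-1\<close>. At
  \<open>x\<close> and at \<open>y\<close> it is compared with the slope \<open>C\<close> of the
  chord between them: initial slopes at \<open>x\<close> are at most \<open>C\<close>, those at
  \<open>y\<close> at least \<open>C\<close>.\<close>

lemma qa_le_imp_right_derivative_ratio_mono:
  assumes I: "is_interval I"
    and f: "continuous_on I f" "strict_mono_on I f"
    and k: "continuous_on I k" "strict_mono_on I k"
    and le: "qa_le I f k"
    and e: "\<And>x. x \<in> interior I \<Longrightarrow> (f has_real_derivative e x) (at_right x)"
      "\<And>x. x \<in> interior I \<Longrightarrow> e x > 0"
    and d: "\<And>x. x \<in> interior I \<Longrightarrow> (k has_real_derivative d x) (at_right x)"
  shows "mono_on (interior I) (\<lambda>x. d x / e x)"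
proof (rule monotone_onI)
  fix x y assume xy: "x \<in> interior I" "y \<in> interior I" "x \<le> y"
  have I': "x \<in> I" "y \<in> I" using xy interior_subset by auto
  have lim: "((\<lambda>w. (k w - k u) / (f w - f u)) \<longlongrightarrow> d u / e u) (at_right u)" if "u \<in> interior I" for u
    using slope_tendsto_right[OF e(1) _ d] e(2) that by (metis less_irrefl)
  have fless: "f a < f b" if "a \<in> I" "b \<in> I" "a < b" for a b using strict_mono_onD[OF f(2)] that by blast
  show "d x / e x \<le> d y / e y"
  proof (cases "x = y")
    case False
    then have "x < y" using xy by simp
    define C where "C = (k y - k x) / (f y - f x)"
    have "d x / e x \<le> C"
    proof (rule tendsto_upperbound[OF lim[OF xy(1)]])
      show "\<forall>\<^sub>F w in at_right x. (k w - k x) / (f w - f x) \<le> C"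
        using eventually_at_right_real[OF \<open>x < y\<close>]
      proof eventually_elim
        case (elim w)
        then have "w \<in> I" using I I' unfolding is_interval_1 by (meson greaterThanLessThan_iff less_imp_le)
        have "(k w - k x) * (f y - f w) \<le> (k y - k w) * (f w - f x)"
          using qa_le_chord[OF I f k le I'] elim by auto
        then have "(k w - k x) * (f y - f x) \<le> (k y - k x) * (f w - f x)" by (simp add: algebra_simps)
        then show ?case using fless[of x w] fless[of x y] I' \<open>w \<in> I\<close> \<open>x < y\<close> elim
          by (simp add: C_def divide_simps)
      qed
    qed simp
    also have "C \<le> d y / e y"
    proof (rule tendsto_lowerbound[OF lim[OF xy(2)]])
      obtain z where "y < z" "z \<in> I"
        using open_real_neighbours[OF open_interior xy(2)] interior_subset by blast
      show "\<forall>\<^sub>F w in at_right y. C \<le> (k w - k y) / (f w - f y)"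
        using eventually_at_right_real[OF \<open>y < z\<close>]
      proof eventually_elim
        case (elim w)
        then have "w \<in> I" using I I' \<open>z \<in> I\<close> unfolding is_interval_1
          by (meson greaterThanLessThan_iff less_imp_le)
        have "(k y - k x) * (f w - f y) \<le> (k w - k y) * (f y - f x)"
          using qa_le_chord[OF I f k le I'(1) \<open>w \<in> I\<close> \<open>x < y\<close>] elim by auto
        then show ?case using fless[of y w] fless[of x y] I' \<open>w \<in> I\<close> \<open>x < y\<close> elim
          by (simp add: C_def divide_simps mult.commute)
      qed
    qed simp
    finally show ?thesis .
  qed simp
qed

text \<open>The ratio of the right derivatives at the mean \<open>m\<close> is the slope of a supporting line of
  \<open>k \<circ> f\<^sup>-\<^sup>1\<close>, so Jensen's inequality applies; if \<open>m\<close> is an end point of \<open>I\<close>, all entries equal \<open>m\<close>.\<close>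

lemma qa_leI_right_derivative_ratio:
  assumes I: "is_interval I"
    and f: "continuous_on I f" "strict_mono_on I f"
    and k: "continuous_on I k" "strict_mono_on I k"
    and e: "\<And>x. x \<in> interior I \<Longrightarrow> (f has_real_derivative e x) (at_right x)"
      "\<And>x. x \<in> interior I \<Longrightarrow> e x > 0"
    and d: "\<And>x. x \<in> interior I \<Longrightarrow> (k has_real_derivative d x) (at_right x)"
    and mono: "mono_on (interior I) (\<lambda>x. d x / e x)"
  shows "qa_le I f k"
  unfolding qa_le_iff_sum[OF I f k]
proof (intro allI impI, elim conjE)
  fix v m assume v: "v \<noteq> []" "set v \<subseteq> I" and m: "m \<in> I" "real (length v) * f m = (\<Sum>x\<leftarrow>v. f x)"
  have sum0: "(\<Sum>x\<leftarrow>v. f x - f m) = 0" using m(2) by (simp add: sum_list_subtractf sum_list_triv)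
  have "\<exists>c. \<forall>z\<in>set v. c * (f z - f m) \<le> k z - k m"
  proof (cases "m \<in> interior I")
    case True
    define c where "c = d m / e m"
    have "c * (f z - f m) \<le> k z - k m" if "z \<in> I" for z
    proof (cases "m \<le> z")
      case True
      have sub: "{m..z} \<subseteq> I" using I m that unfolding is_interval_1 by (meson atLeastAtMost_iff subsetI)
      \<comment> \<open>To the right of \<open>m\<close> the ratio \<open>d / e\<close> is at least
        \<open>c\<close>, so \<open>c * f - k\<close> has nonpositive right derivatives there. To
        the left the signs are reversed.\<close>
      have "c * f z - k z \<le> c * f m - k m"
      proof (rule right_derivative_nonpos_imp_le[OF True])
        show "continuous_on {m..z} (\<lambda>x. c * f x - k x)"
          using f(1) k(1) sub by (intro continuous_intros) (auto intro: continuous_on_subset)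
        fix x assume x: "m < x" "x < z"
        then have xI: "x \<in> interior I" using between_in_interior[OF I m(1) that] by simp
        have "c \<le> d x / e x" using monotone_onD[OF mono \<open>m \<in> interior I\<close> xI] x by (simp add: c_def)
        then have "c * e x - d x \<le> 0" using e(2)[OF xI] by (simp add: field_simps)
        moreover have "((\<lambda>x. c * f x - k x) has_real_derivative c * e x - d x) (at_right x)"
          by (intro derivative_intros DERIV_cmult e(1) d xI)
        ultimately show "\<exists>r\<le>0. ((\<lambda>x. c * f x - k x) has_real_derivative r) (at_right x)" by blast
      qed
      then show ?thesis by (simp add: algebra_simps)
    next
      case False
      then have zm: "z \<le> m" by simp
      have sub: "{z..m} \<subseteq> I" using I m that unfolding is_interval_1 by (meson atLeastAtMost_iff subsetI)
      have "k m - c * f m \<le> k z - c * f z"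
      proof (rule right_derivative_nonpos_imp_le[OF zm])
        show "continuous_on {z..m} (\<lambda>x. k x - c * f x)"
          using f(1) k(1) sub by (intro continuous_intros) (auto intro: continuous_on_subset)
        fix x assume x: "z < x" "x < m"
        then have xI: "x \<in> interior I" using between_in_interior[OF I that m(1)] by simp
        have "d x / e x \<le> c" using monotone_onD[OF mono xI \<open>m \<in> interior I\<close>] x by (simp add: c_def)
        then have "d x - c * e x \<le> 0" using e(2)[OF xI] by (simp add: field_simps)
        moreover have "((\<lambda>x. k x - c * f x) has_real_derivative d x - c * e x) (at_right x)"
          by (intro derivative_intros DERIV_cmult e(1) d xI)
        ultimately show "\<exists>r\<le>0. ((\<lambda>x. k x - c * f x) has_real_derivative r) (at_right x)" by blast
      qed
      then show ?thesis by (simp add: algebra_simps)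
    qed
    then show ?thesis using v(2) by blast
  next
    case False
    \<comment> \<open>At an end point all differences \<open>f z - f m\<close> have the same sign;
      as they sum to zero over \<open>v\<close>, each of them vanishes.\<close>
    then have "(\<forall>z\<in>I. m \<le> z) \<or> (\<forall>z\<in>I. z \<le> m)"
      using between_in_interior[OF I] by (meson not_le)
    then have "\<forall>z\<in>set v. f z - f m = 0"
    proof
      assume *: "\<forall>z\<in>I. m \<le> z"
      have "\<And>z. z \<in> set v \<Longrightarrow> 0 \<le> f z - f m"
        using * v(2) m(1) strict_mono_on_leD[OF f(2)] by (simp add: subset_iff)
      then show ?thesis using sum0 by (subst (asm) sum_list_nonneg_eq_0_iff) auto
    next
      assume *: "\<forall>z\<in>I. z \<le> m"
      have "\<And>z. z \<in> set v \<Longrightarrow> 0 \<le> f m - f z"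
        using * v(2) m(1) strict_mono_on_leD[OF f(2)] by (simp add: subset_iff)
      moreover have "(\<Sum>x\<leftarrow>v. f m - f x) = 0"
        using m(2) by (simp add: sum_list_subtractf sum_list_triv)
      ultimately show ?thesis by (subst (asm) sum_list_nonneg_eq_0_iff) auto
    qed
    then have "\<forall>z\<in>set v. z = m"
      using v(2) m(1) strict_mono_on_imp_inj_on[OF f(2)] by (auto simp: inj_on_def)
    then show ?thesis by auto
  qed
  then obtain c where "\<And>z. z \<in> set v \<Longrightarrow> c * (f z - f m) \<le> k z - k m" by blast
  then have "(\<Sum>x\<leftarrow>v. c * (f x - f m)) \<le> (\<Sum>x\<leftarrow>v. k x - k m)" by (rule sum_list_mono)
  then have "0 \<le> (\<Sum>x\<leftarrow>v. k x - k m)" using sum0 by (simp add: sum_list_const_mult)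
  then show "real (length v) * k m \<le> (\<Sum>x\<leftarrow>v. k x)" by (simp add: sum_list_subtractf sum_list_triv)
qed

subsection \<open>Construction of the least upper bound\<close>

text \<open>A monotone function has its infimum or supremum as limit at an end point. Boundedness is
  demanded only on a side where the end point belongs to \<open>I\<close>, since only there a finite
  value has to be assigned.\<close>

lemma monotone_extension_to_end_points:
  fixes U :: "real \<Rightarrow> real"
  assumes I: "is_interval I" and ne: "interior I \<noteq> {}"
    and cont: "continuous_on (interior I) U" and mono: "mono_on (interior I) U"
    and below: "\<And>a. a \<in> I \<Longrightarrow> (\<And>y. y \<in> interior I \<Longrightarrow> a < y) \<Longrightarrow> bdd_below (U ` interior I)"
    and above: "\<And>b. b \<in> I \<Longrightarrow> (\<And>y. y \<in> interior I \<Longrightarrow> y < b) \<Longrightarrow> bdd_above (U ` interior I)"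
  obtains u where "continuous_on I u" "\<And>x. x \<in> interior I \<Longrightarrow> u x = U x"
proof
  let ?J = "interior I"
  define u where "u x = (if x \<in> ?J then U x else if \<forall>y\<in>?J. x < y then Inf (U ` ?J) else Sup (U ` ?J))" for x
  show uU: "u x = U x" if "x \<in> ?J" for x using that by (simp add: u_def)
  have JI: "y \<in> I" if "y \<in> ?J" for y using that interior_subset by blast
  show "continuous_on I u"
    unfolding continuous_on_eq_continuous_within
  proof
    fix x assume x: "x \<in> I"
    show "continuous (at x within I) u"
    proof (cases "x \<in> ?J")
      case True
      have "continuous_on ?J u" by (rule continuous_on_eq[OF cont]) (simp add: uU)
      then show ?thesis
        using True continuous_on_interior[of ?J u x] continuous_at_imp_continuous_at_within by simp
    next
      case False
      have btw: "z \<in> ?J" if "a \<in> I" "b \<in> I" "a < z" "z < b" for a b z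
        using between_in_interior[OF I] that by blast
      have "(\<forall>y\<in>?J. x < y) \<or> (\<forall>y\<in>?J. y < x)"
      proof (rule ccontr)
        assume "\<not> ?thesis"
        then obtain y1 y2 where y: "y1 \<in> ?J" "y2 \<in> ?J" "y1 \<le> x" "x \<le> y2" by (auto simp: not_less)
        then have "y1 < x" "x < y2" using False by (auto simp: order_le_less)
        then show False using btw[of y1 y2 x] JI y False by blast
      qed
      then show ?thesis
      proof
        assume less: "\<forall>y\<in>?J. x < y"
        have bdd: "bdd_below (U ` ?J)" by (rule below[OF x]) (use less in blast)
        have ux: "u x = Inf (U ` ?J)" using False less by (simp add: u_def)
        show ?thesis unfolding continuous_within
        proof (rule tendstoI)
          fix e :: real assume "e > 0"
          then have "Inf (U ` ?J) < Inf (U ` ?J) + e" by simp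
          \<comment> \<open>One such \<open>y\<close> controls all points between \<open>x\<close>
            and \<open>y\<close>, because \<open>U\<close> is monotone.\<close>
          then obtain y where y: "y \<in> ?J" "U y < Inf (U ` ?J) + e"
            using ne by (subst (asm) cInf_less_iff[OF _ bdd]) auto
          have "\<forall>\<^sub>F z in at x within I. z \<in> {..<y}"
            unfolding eventually_at_topological using less y(1) by (intro exI[of _ "{..<y}"]) auto
          moreover have "\<forall>\<^sub>F z in at x within I. z \<in> I \<and> z \<noteq> x"
            by (auto simp: eventually_at_filter)
          ultimately show "\<forall>\<^sub>F z in at x within I. dist (u z) (u x) < e"
          proof eventually_elim
            case (elim z)
            \<comment> \<open>Otherwise \<open>x\<close> would lie strictly between the points
              \<open>z\<close> and \<open>y\<close> of \<open>I\<close> and would thus be an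
              interior point.\<close>
            have "x < z"
              using btw[of z y x] elim x JI[OF y(1)] less False y(1) by (metis lessThan_iff linorder_neqE)
            then have z: "z \<in> ?J" using btw[of x y z] x JI[OF y(1)] elim by simp
            have "Inf (U ` ?J) \<le> U z" using bdd z by (simp add: cInf_lower)
            moreover have "U z \<le> U y" using monotone_onD[OF mono z y(1)] elim by simp
            ultimately show ?case using y(2) ux uU[OF z] by (simp add: dist_real_def)
          qed
        qed
      next
        assume less: "\<forall>y\<in>?J. y < x"
        have bdd: "bdd_above (U ` ?J)" by (rule above[OF x]) (use less in blast)
        obtain c where c: "c \<in> ?J" using ne by blast
        then have "\<not> (\<forall>y\<in>?J. x < y)" using less by force
        then have ux: "u x = Sup (U ` ?J)" using False unfolding u_def by (simp only: if_False)
        show ?thesis unfolding continuous_within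
        proof (rule tendstoI)
          fix e :: real assume "e > 0"
          then have "Sup (U ` ?J) - e < Sup (U ` ?J)" by simp
          then obtain y where y: "y \<in> ?J" "Sup (U ` ?J) - e < U y"
            using ne by (subst (asm) less_cSup_iff[OF _ bdd]) auto
          have "\<forall>\<^sub>F z in at x within I. z \<in> {y<..}"
            unfolding eventually_at_topological using less y(1) by (intro exI[of _ "{y<..}"]) auto
          moreover have "\<forall>\<^sub>F z in at x within I. z \<in> I \<and> z \<noteq> x"
            by (auto simp: eventually_at_filter)
          ultimately show "\<forall>\<^sub>F z in at x within I. dist (u z) (u x) < e"
          proof eventually_elim
            case (elim z)
            have "z < x"
              using btw[of y z x] elim x JI[OF y(1)] less False y(1) by (metis greaterThan_iff linorder_neqE)
            then have z: "z \<in> ?J" using btw[of y x z] x JI[OF y(1)] elim by simp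
            have "U z \<le> Sup (U ` ?J)" using bdd z by (simp add: cSup_upper)
            moreover have "U y \<le> U z" using monotone_onD[OF mono y(1) z] elim by simp
            ultimately show ?case using y(2) ux uU[OF z] by (simp add: dist_real_def)
          qed
        qed
      qed
    qed
  qed
qed

lemma antiderivative_on_open_interval:
  fixes p :: "real \<Rightarrow> real"
  assumes "open J" "is_interval J" "continuous_on J p"
  obtains P where "\<And>x. x \<in> J \<Longrightarrow> (P has_real_derivative p x) (at x)"
proof (cases "J = {}")
  case False
  then obtain c where c: "c \<in> J" by blast
  define P where "P x = (if c \<le> x then integral {c..x} p else - integral {x..c} p)" for x
  have "(P has_real_derivative p x) (at x)" if x: "x \<in> J" for x
  proof -
    \<comment> \<open>Integrating from a point \<open>l\<close> to the left of both \<open>c\<close>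
      and \<open>x\<close> avoids the case distinction in \<open>P\<close>: on
      \<open>{l<..<r}\<close> the function \<open>P\<close> is the integral from \<open>l\<close>
      minus a constant.\<close>
    obtain l r where lr: "l < min c x" "max c x < r" "l \<in> J" "r \<in> J"
      using open_real_neighbours[OF assms(1), of "min c x"] open_real_neighbours[OF assms(1), of "max c x"] c x
      by (metis max_def min_def)
    have "{l..r} \<subseteq> J" using assms(2) lr unfolding is_interval_1 by (meson atLeastAtMost_iff subsetI)
    then have cont: "continuous_on {l..r} p" using assms(3) continuous_on_subset by blast
    have int: "p integrable_on {a..b}" if "l \<le> a" "b \<le> r" for a b
      using cont that by (intro integrable_continuous_real) (auto intro: continuous_on_subset)
    have "((\<lambda>t. integral {l..t} p) has_real_derivative p x) (at x within {l..r})"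
      using lr by (intro integral_has_real_derivative[OF cont]) auto
    then have "((\<lambda>t. integral {l..t} p - integral {l..c} p) has_real_derivative p x) (at x within {l..r})"
      by (auto intro!: derivative_eq_intros)
    then have "((\<lambda>t. integral {l..t} p - integral {l..c} p) has_real_derivative p x) (at x)"
      using lr by (simp add: at_within_Icc_at)
    moreover have "integral {l..t} p - integral {l..c} p = P t" if "t \<in> {l<..<r}" for t
      using Henstock_Kurzweil_Integration.integral_combine[of l c t p]
        Henstock_Kurzweil_Integration.integral_combine[of l t c p] int[of l t] int[of l c] that lr
      by (auto simp: P_def)
    ultimately show ?thesis
      using has_field_derivative_transform_within_open[of _ "p x" x "{l<..<r}" P] lr by simp
  qed
  then show ?thesis using that by blast
qed (use that in auto)

lemma C1sharp_deriv:
  assumes "f \<in> C1sharp I" "strict_mono_on I f"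
  shows "\<And>x. x \<in> interior I \<Longrightarrow> (f has_real_derivative deriv f x) (at x)"
    and "continuous_on (interior I) (deriv f)"
    and "\<And>x. x \<in> interior I \<Longrightarrow> deriv f x > 0"
proof -
  obtain D where D: "\<And>x. x \<in> interior I \<Longrightarrow> (f has_real_derivative D x) (at x)"
    and contD: "continuous_on (interior I) D"
    using assms(1) unfolding C1sharp_def C1_differentiable_on_def
    by (auto simp: has_real_derivative_iff_has_vector_derivative)
  have eq: "deriv f x = D x" if "x \<in> interior I" for x using D[OF that] by (rule DERIV_imp_deriv)
  show der: "(f has_real_derivative deriv f x) (at x)" if "x \<in> interior I" for x
    using D[OF that] eq[OF that] by simp
  show "continuous_on (interior I) (deriv f)"
    by (rule continuous_on_eq[OF contD]) (simp add: eq)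
  show "deriv f x > 0" if "x \<in> interior I" for x
  proof -
    have "deriv f x \<ge> 0"
      using mono_on_imp_deriv_nonneg[OF strict_mono_on_imp_mono_on[OF assms(2)] der] that by blast
    moreover have "deriv f x \<noteq> 0" using assms(1) that by (simp add: C1sharp_def)
    ultimately show ?thesis by simp
  qed
qed

text \<open>With \<open>u' = exp M\<close>, the domination property of \<open>M\<close> says that
  \<open>u' / f'\<close> is nondecreasing, and its minimality says that \<open>d / u'\<close> is
  nondecreasing for the right derivative \<open>d\<close> of any upper bound. Both halves then
  follow from \<open>qa_leI_right_derivative_ratio\<close>.\<close>

lemma least_upper_bound_increasing:
  assumes nt: "nontrivial_interval I" and ne: "F \<noteq> {}"
    and F: "\<And>f. f \<in> F \<Longrightarrow> f \<in> C1sharp I" "\<And>f. f \<in> F \<Longrightarrow> strict_mono_on I f"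
    and g: "continuous_on I g" "strict_mono_on I g" "\<And>f. f \<in> F \<Longrightarrow> qa_le I f g"
  obtains u where "u \<in> C1sharp I" "strict_mono_on I u" "\<And>f. f \<in> F \<Longrightarrow> qa_le I f u"
    "\<And>k. continuous_on I k \<Longrightarrow> strict_mono_on I k \<Longrightarrow> (\<And>f. f \<in> F \<Longrightarrow> qa_le I f k) \<Longrightarrow> qa_le I u k"
proof -
  let ?J = "interior I"
  have I: "is_interval I" using nt by (simp add: nontrivial_interval_def)
  obtain a0 b0 where "a0 \<in> I" "b0 \<in> I" "a0 < b0" using nt by (auto simp: nontrivial_interval_def)
  then have "(a0 + b0) / 2 \<in> ?J" by (intro between_in_interior[OF I, of a0 b0]) auto
  then obtain c where c: "c \<in> ?J" by blast
  have JI: "y \<in> I" if "y \<in> ?J" for y using that interior_subset by blast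
  have J: "is_interval ?J"
    using I by (simp add: is_interval_convex_1 convex_interior)
  have Icc: "{x..y} \<subseteq> I" if "x \<in> I" "y \<in> I" for x y
    using I that unfolding is_interval_1 by (meson atLeastAtMost_iff subsetI)
  have Fcont: "continuous_on I f" if "f \<in> F" for f using F(1)[OF that] by (simp add: C1sharp_def)
  note Fderiv = C1sharp_deriv[OF F]
  have Fright: "(f has_real_derivative deriv f x) (at_right x)" if "f \<in> F" "x \<in> ?J" for f x
    using Fderiv(1)[OF that(1) that(1) that(2)] by (rule has_field_derivative_at_within)
  \<comment> \<open>Logarithms turn monotone ratios of derivatives into monotone differences, the
    form required by \<open>least_increments\<close>.\<close>
  define L where "L = (\<lambda>f x. ln (deriv f x)) ` F"
  \<comment> \<open>Used twice: for \<open>g\<close>, to have a competitor at all, and for an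
    arbitrary upper bound \<open>k\<close>, to prove minimality of \<open>u\<close>.\<close>
  have upper: "\<exists>d. (\<forall>x\<in>?J. (k has_real_derivative d x) (at_right x) \<and> d x > 0) \<and>
      (\<forall>l\<in>L. mono_on ?J (\<lambda>x. ln (d x) - l x))"
    if k: "continuous_on I k" "strict_mono_on I k" and le: "\<And>f. f \<in> F \<Longrightarrow> qa_le I f k" for k
  proof -
    obtain f0 where f0: "f0 \<in> F" using ne by blast
    have "\<exists>d. (k has_real_derivative d) (at_right x) \<and> d > 0" if "x \<in> ?J" for x
      using qa_le_right_derivative_exists[OF I Fcont[OF f0] F(2)[OF f0] k le[OF f0] that
          Fright[OF f0 that] Fderiv(3)[OF f0 f0 that]] by blast
    then obtain d where d: "\<And>x. x \<in> ?J \<Longrightarrow> (k has_real_derivative d x) (at_right x)"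
      "\<And>x. x \<in> ?J \<Longrightarrow> d x > 0" by metis
    have "mono_on ?J (\<lambda>x. ln (d x) - ln (deriv f x))" if f: "f \<in> F" for f
    proof (rule monotone_onI)
      fix x y assume xy: "x \<in> ?J" "y \<in> ?J" "x \<le> y"
      have "d x / deriv f x \<le> d y / deriv f y"
        using monotone_onD[OF qa_le_imp_right_derivative_ratio_mono[OF I Fcont[OF f] F(2)[OF f] k le[OF f]
            Fright[OF f] Fderiv(3)[OF f f] d(1)] xy] .
      then have "ln (d x / deriv f x) \<le> ln (d y / deriv f y)"
        using d(2) Fderiv(3)[OF f f] xy by simp
      then show "ln (d x) - ln (deriv f x) \<le> ln (d y) - ln (deriv f y)"
        using d(2)[OF xy(1)] d(2)[OF xy(2)] Fderiv(3)[OF f f xy(1)] Fderiv(3)[OF f f xy(2)]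
        by (simp add: ln_div)
    qed
    then show ?thesis using d by (auto simp: L_def)
  qed
  obtain dg where dg: "\<And>x. x \<in> ?J \<Longrightarrow> (g has_real_derivative dg x) (at_right x)"
    "\<And>x. x \<in> ?J \<Longrightarrow> dg x > 0" "\<And>l. l \<in> L \<Longrightarrow> mono_on ?J (\<lambda>x. ln (dg x) - l x)"
    using upper[OF g] by blast
  have Lcont: "continuous_on ?J l" if "l \<in> L" for l
    using that Fderiv(2,3) unfolding L_def by (force intro!: continuous_on_ln)
  obtain M where Mcont: "continuous_on ?J M"
    and M_upper: "\<And>l. l \<in> L \<Longrightarrow> mono_on ?J (\<lambda>x. M x - l x)"
    and M_least: "\<And>G. (\<And>l. l \<in> L \<Longrightarrow> mono_on ?J (\<lambda>x. G x - l x)) \<Longrightarrow> mono_on ?J (\<lambda>x. G x - M x)"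
    by (rule least_increments[of ?J L "\<lambda>x. ln (dg x)"])
       (use c ne Lcont dg(3) in \<open>auto simp: L_def\<close>)
  obtain U where U: "\<And>x. x \<in> ?J \<Longrightarrow> (U has_real_derivative exp (M x)) (at x)"
    using antiderivative_on_open_interval[of ?J "\<lambda>x. exp (M x)"] J Mcont
    by (metis continuous_on_exp open_interior)
  have Ucont: "continuous_on ?J U"
    using U by (intro DERIV_continuous_on) (blast intro: has_field_derivative_at_within)
  have Umono: "mono_on ?J U"
  proof (rule monotone_onI)
    fix x y assume xy: "x \<in> ?J" "y \<in> ?J" "x \<le> y"
    have "t \<in> ?J" if "x \<le> t" "t \<le> y" for t using J xy that unfolding is_interval_1 by blast
    then show "U x \<le> U y"
      using U exp_ge_zero by (intro DERIV_nonneg_imp_nondecreasing[OF xy(3)]) blast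
  qed
  have compare: "U y - U x \<le> K * (h y - h x)"
    if xy: "x \<in> ?J" "y \<in> ?J" "x \<le> y" and h: "continuous_on I h"
      and dh: "\<And>t. t \<in> ?J \<Longrightarrow> (h has_real_derivative d t) (at_right t)"
      and le: "\<And>t. x < t \<Longrightarrow> t < y \<Longrightarrow> t \<in> ?J \<Longrightarrow> exp (M t) \<le> K * d t" for x y h d K
  proof -
    have sub: "{x..y} \<subseteq> ?J" using J xy unfolding is_interval_1 by (meson atLeastAtMost_iff subsetI)
    have "U y - K * h y \<le> U x - K * h x"
    proof (rule right_derivative_nonpos_imp_le[OF xy(3)])
      show "continuous_on {x..y} (\<lambda>t. U t - K * h t)"
        using sub h Ucont interior_subset[of I]
        by (intro continuous_intros) (blast intro: continuous_on_subset)+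
      fix t assume t: "x < t" "t < y"
      then have tJ: "t \<in> ?J" using sub by auto
      have "((\<lambda>t. U t - K * h t) has_real_derivative exp (M t) - K * d t) (at_right t)"
        by (intro DERIV_diff DERIV_cmult dh has_field_derivative_at_within[OF U] tJ)
      then show "\<exists>r\<le>0. ((\<lambda>t. U t - K * h t) has_real_derivative r) (at_right t)"
        using le[OF t tJ] by (metis diff_le_0_iff_le)
    qed
    then show ?thesis by (simp add: algebra_simps)
  qed
  have below: "bdd_below (U ` ?J)" if a: "a \<in> I" "\<And>y. y \<in> ?J \<Longrightarrow> a < y" for a
  proof -
    obtain f where f: "f \<in> F" using ne by blast
    \<comment> \<open>The value of \<open>exp M / f'\<close> at \<open>c\<close>. This quotient is
      nondecreasing, so \<open>exp M \<le> K * f'\<close> to the left of \<open>c\<close>, and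
      \<open>U\<close> falls there by at most \<open>K * (f c - f a)\<close>.\<close>
    define K where "K = exp (M c - ln (deriv f c))"
    have "U c - K * (f c - f a) \<le> U y" if y: "y \<in> ?J" for y
    proof (cases "y \<le> c")
      case True
      have "U c - U y \<le> K * (f c - f y)"
      proof (rule compare[OF y c True Fcont[OF f] Fright[OF f]])
        fix t assume t: "y < t" "t < c" "t \<in> ?J"
        have "M t - ln (deriv f t) \<le> M c - ln (deriv f c)"
          using M_upper[of "\<lambda>x. ln (deriv f x)"] f c t by (auto simp: L_def monotone_on_def)
        then have "exp (M t) \<le> exp (M c - ln (deriv f c) + ln (deriv f t))" by simp
        then show "exp (M t) \<le> K * deriv f t"
          using Fderiv(3)[OF f f t(3)] by (simp add: K_def exp_add)
      qed
      also have "\<dots> \<le> K * (f c - f a)"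
        using strict_mono_onD[OF F(2)[OF f] a(1) JI[OF y] a(2)[OF y]]
        by (intro mult_left_mono) (auto simp: K_def)
      finally show ?thesis by simp
    next
      case False
      then have "U c \<le> U y" using monotone_onD[OF Umono c y] by simp
      moreover have "0 \<le> K * (f c - f a)"
        using strict_mono_onD[OF F(2)[OF f] a(1) JI[OF c] a(2)[OF c]] by (simp add: K_def)
      ultimately show ?thesis by simp
    qed
    then show ?thesis by (rule bdd_belowI2)
  qed
  have above: "bdd_above (U ` ?J)" if b: "b \<in> I" "\<And>y. y \<in> ?J \<Longrightarrow> y < b" for b
  proof -
    \<comment> \<open>Here minimality of \<open>M\<close> is what counts: \<open>exp M / dg\<close>
      is nonincreasing, so the increments of \<open>U\<close> to the right of \<open>c\<close> are
      at most \<open>K\<close> times those of \<open>g\<close>.\<close>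
    define K where "K = exp (M c - ln (dg c))"
    have "U y \<le> U c + K * (g b - g c)" if y: "y \<in> ?J" for y
    proof (cases "c \<le> y")
      case True
      have "U y - U c \<le> K * (g y - g c)"
      proof (rule compare[OF c y True g(1) dg(1)])
        fix t assume t: "c < t" "t < y" "t \<in> ?J"
        have "ln (dg c) - M c \<le> ln (dg t) - M t"
          using M_least[OF dg(3)] c t by (auto simp: monotone_on_def)
        then have "exp (M t) \<le> exp (M c - ln (dg c) + ln (dg t))" by simp
        then show "exp (M t) \<le> K * dg t"
          using dg(2)[OF t(3)] by (simp add: K_def exp_add)
      qed
      also have "\<dots> \<le> K * (g b - g c)"
        using strict_mono_onD[OF g(2) JI[OF y] b(1) b(2)[OF y]]
        by (intro mult_left_mono) (auto simp: K_def)
      finally show ?thesis by simp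
    next
      case False
      then have "U y \<le> U c" using monotone_onD[OF Umono y c] by simp
      moreover have "0 \<le> K * (g b - g c)"
        using strict_mono_onD[OF g(2) JI[OF c] b(1) b(2)[OF c]] by (simp add: K_def)
      ultimately show ?thesis by simp
    qed
    then show ?thesis by (rule bdd_aboveI2)
  qed
  obtain u where ucont: "continuous_on I u" and uU: "\<And>x. x \<in> ?J \<Longrightarrow> u x = U x"
  proof (rule monotone_extension_to_end_points[OF I _ Ucont Umono])
    show "?J \<noteq> {}" using c by blast
    show "bdd_below (U ` ?J)" if "a \<in> I" "\<And>y. y \<in> ?J \<Longrightarrow> a < y" for a using that by (rule below)
    show "bdd_above (U ` ?J)" if "b \<in> I" "\<And>y. y \<in> ?J \<Longrightarrow> y < b" for b using that by (rule above)
  qed (use that in auto)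
  have uder: "(u has_real_derivative exp (M x)) (at x)" if "x \<in> ?J" for x
    by (rule has_field_derivative_transform_within_open[OF U[OF that] open_interior that]) (simp add: uU)
  have uright: "(u has_real_derivative exp (M x)) (at_right x)" if "x \<in> ?J" for x
    using uder[OF that] by (rule has_field_derivative_at_within)
  have umono: "strict_mono_on I u"
  proof (rule strict_mono_onI)
    fix x y assume xy: "x \<in> I" "y \<in> I" "x < y"
    show "u x < u y"
    proof (rule DERIV_pos_imp_increasing_open[OF xy(3)])
      show "continuous_on {x..y} u" using ucont Icc[OF xy(1,2)] by (rule continuous_on_subset)
      show "\<exists>r. (u has_real_derivative r) (at t) \<and> r > 0" if "x < t" "t < y" for t
        using uder between_in_interior[OF I xy(1,2) that] exp_gt_zero by blast
    qed
  qed
  have "u \<in> C1sharp I"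
    unfolding C1sharp_def C1_differentiable_on_def
    using ucont uder Mcont
    by (auto simp: DERIV_imp_deriv[OF uder] has_real_derivative_iff_has_vector_derivative[symmetric]
        intro!: exI[of _ "\<lambda>x. exp (M x)"] continuous_on_exp)
  moreover have "qa_le I f u" if f: "f \<in> F" for f
  proof (rule qa_leI_right_derivative_ratio[OF I Fcont[OF f] F(2)[OF f] ucont umono
        Fright[OF f] Fderiv(3)[OF f f] uright])
    show "mono_on ?J (\<lambda>x. exp (M x) / deriv f x)"
    proof (rule monotone_onI)
      fix x y assume xy: "x \<in> ?J" "y \<in> ?J" "x \<le> y"
      have "M x - ln (deriv f x) \<le> M y - ln (deriv f y)"
        using M_upper[of "\<lambda>x. ln (deriv f x)"] f xy by (auto simp: L_def monotone_on_def)
      then have "exp (M x - ln (deriv f x)) \<le> exp (M y - ln (deriv f y))" by simp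
      then show "exp (M x) / deriv f x \<le> exp (M y) / deriv f y"
        using Fderiv(3)[OF f f] xy by (simp add: exp_diff)
    qed
  qed
  moreover have "qa_le I u k"
    if k: "continuous_on I k" "strict_mono_on I k" and le: "\<And>f. f \<in> F \<Longrightarrow> qa_le I f k" for k
  proof -
    obtain d where d: "\<And>x. x \<in> ?J \<Longrightarrow> (k has_real_derivative d x) (at_right x)"
      "\<And>x. x \<in> ?J \<Longrightarrow> d x > 0" "\<And>l. l \<in> L \<Longrightarrow> mono_on ?J (\<lambda>x. ln (d x) - l x)"
      using upper[OF k le] by blast
    show ?thesis
    proof (rule qa_leI_right_derivative_ratio[OF I ucont umono k uright exp_gt_zero d(1)])
      show "mono_on ?J (\<lambda>x. d x / exp (M x))"
      proof (rule monotone_onI)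
        fix x y assume xy: "x \<in> ?J" "y \<in> ?J" "x \<le> y"
        have "ln (d x) - M x \<le> ln (d y) - M y" using monotone_onD[OF M_least[OF d(3)] xy] .
        then have "exp (ln (d x) - M x) \<le> exp (ln (d y) - M y)" by simp
        then show "d x / exp (M x) \<le> d y / exp (M y)"
          using d(2) xy by (simp add: exp_diff)
      qed
    qed
  qed
  ultimately show ?thesis using that umono by blast
qed

subsection \<open>Sign normalisation and reflection\<close>

text \<open>A function in \<open>CM I\<close> and its negative generate the same mean, so every mean
  has an increasing generator.\<close>

definition increasing_version :: "real set \<Rightarrow> (real \<Rightarrow> real) \<Rightarrow> real \<Rightarrow> real" where
  "increasing_version I f = (if strict_mono_on I f then f else (\<lambda>x. - f x))"

lemma increasing_version_CM:
  assumes "f \<in> CM I"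
  shows "increasing_version I f \<in> CM I" "strict_mono_on I (increasing_version I f)"
  using assms
  by (auto simp: increasing_version_def CM_def monotone_on_def intro: continuous_on_minus)

lemma increasing_version_C1sharp:
  assumes "f \<in> C1sharp I"
  shows "increasing_version I f \<in> C1sharp I"
proof -
  have "(\<lambda>x. - f x) \<in> C1sharp I"
  proof -
    have f: "f differentiable at x" if "x \<in> interior I" for x
      using assms that by (auto simp: C1sharp_def C1_differentiable_on_eq)
    have "deriv (\<lambda>x. - f x) x = - deriv f x" if "x \<in> interior I" for x
      using f[OF that] by (intro DERIV_imp_deriv DERIV_minus) (simp add: DERIV_deriv_iff_real_differentiable)
    then show ?thesis
      using assms by (auto simp: C1sharp_def intro: continuous_on_minus C1_differentiable_on_minus)
  qed
  then show ?thesis using assms by (simp add: increasing_version_def)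
qed

lemma qa_le_increasing_version:
  assumes "is_interval I" "f \<in> CM I" "k \<in> CM I"
  shows "qa_le I (increasing_version I f) (increasing_version I k) \<longleftrightarrow> qa_le I f k"
  using assms by (auto simp: qa_le_def increasing_version_def qa_mean_uminus)

lemma least_upper_bound:
  assumes nt: "nontrivial_interval I" and F: "F \<subseteq> C1sharp I" "F \<noteq> {}"
    and g: "g \<in> CM I" "\<forall>f\<in>F. qa_le I f g"
  shows "\<exists>u\<in>C1sharp I. (\<forall>f\<in>F. qa_le I f u) \<and> (\<forall>k\<in>CM I. (\<forall>f\<in>F. qa_le I f k) \<longrightarrow> qa_le I u k)"
proof -
  have I: "is_interval I" using nt by (simp add: nontrivial_interval_def)
  let ?inc = "increasing_version I"
  have FCM: "f \<in> CM I" if "f \<in> F" for f using that F(1) C1sharp_subset_CM[OF nt] by blast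
  have cont: "continuous_on I f" if "f \<in> CM I" for f using that by (simp add: CM_def)
  have le: "qa_le I h (?inc k)" if "k \<in> CM I" "\<forall>f\<in>F. qa_le I f k" "h \<in> ?inc ` F" for h k
    using that FCM qa_le_increasing_version[OF I] by blast
  obtain u where u: "u \<in> C1sharp I" "strict_mono_on I u" "\<And>f. f \<in> ?inc ` F \<Longrightarrow> qa_le I f u"
    and least: "\<And>k. continuous_on I k \<Longrightarrow> strict_mono_on I k \<Longrightarrow> (\<And>f. f \<in> ?inc ` F \<Longrightarrow> qa_le I f k)
      \<Longrightarrow> qa_le I u k"
  proof (rule least_upper_bound_increasing[OF nt, of "?inc ` F" "?inc g"])
    show "?inc ` F \<noteq> {}" using F(2) by simp
    show "f \<in> C1sharp I" "strict_mono_on I f" if "f \<in> ?inc ` F" for f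
      using that F(1) FCM increasing_version_C1sharp increasing_version_CM(2) by blast+
    show "continuous_on I (?inc g)" "strict_mono_on I (?inc g)"
      using increasing_version_CM[OF g(1)] cont by auto
  qed (use le[OF g] in blast)+
  have uCM: "u \<in> CM I" using u(1) C1sharp_subset_CM[OF nt] by blast
  have inc_u: "?inc u = u" using u(2) by (simp add: increasing_version_def)
  have "qa_le I f u" if "f \<in> F" for f
    using u(3)[of "?inc f"] qa_le_increasing_version[OF I FCM[OF that] uCM] that inc_u by simp
  moreover have "qa_le I u k" if k: "k \<in> CM I" "\<forall>f\<in>F. qa_le I f k" for k
  proof -
    have "qa_le I u (?inc k)"
      using least[OF cont[OF increasing_version_CM(1)[OF k(1)]] increasing_version_CM(2)[OF k(1)] le[OF k]] .
    then show ?thesis using qa_le_increasing_version[OF I uCM k(1)] inc_u by simp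
  qed
  ultimately show ?thesis using u(1) by blast
qed

section \<open>Reflection of the interval at the origin\<close>

lemma continuous_on_reflect:
  fixes f :: "real \<Rightarrow> 'a::topological_space"
  assumes "continuous_on S f"
  shows "continuous_on (uminus ` S) (\<lambda>x. f (- x))"
  by (rule continuous_on_compose2[OF assms continuous_on_minus[OF continuous_on_id]]) auto

lemma CM_reflect:
  assumes "f \<in> CM I"
  shows "(\<lambda>x. f (- x)) \<in> CM (uminus ` I)"
proof -
  have "continuous_on (uminus ` I) (\<lambda>x. f (- x))"
    using assms by (simp add: CM_def continuous_on_reflect)
  then show ?thesis using assms by (auto simp: CM_def monotone_on_def)
qed

lemma C1sharp_reflect:
  assumes "f \<in> C1sharp I"
  shows "(\<lambda>x. f (- x)) \<in> C1sharp (uminus ` I)"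
proof -
  obtain D where D: "\<And>x. x \<in> interior I \<Longrightarrow> (f has_real_derivative D x) (at x)"
    and contD: "continuous_on (interior I) D"
    using assms unfolding C1sharp_def C1_differentiable_on_def
    by (auto simp: has_real_derivative_iff_has_vector_derivative)
  have nz: "D x \<noteq> 0" if "x \<in> interior I" for x
    using assms DERIV_imp_deriv[OF D[OF that]] that by (auto simp: C1sharp_def)
  have der: "((\<lambda>x. f (- x)) has_real_derivative - D (- x)) (at x)" if "x \<in> interior (uminus ` I)" for x
  proof -
    have "- x \<in> interior I" using that by (auto simp: interior_negations)
    then have "((\<lambda>x. f (- x)) has_real_derivative D (- x) * (-1)) (at x)"
      by (intro DERIV_chain2[of f] D) (auto intro!: derivative_eq_intros)
    then show ?thesis by simp
  qed
  have "continuous_on (interior (uminus ` I)) (\<lambda>x. - D (- x))"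
    unfolding interior_negations by (intro continuous_on_minus continuous_on_reflect contD)
  moreover have "continuous_on (uminus ` I) (\<lambda>x. f (- x))"
    using assms by (simp add: C1sharp_def continuous_on_reflect)
  moreover have "deriv (\<lambda>x. f (- x)) x \<noteq> 0" if "x \<in> interior (uminus ` I)" for x
    using DERIV_imp_deriv[OF der[OF that]] nz that by (auto simp: interior_negations)
  ultimately show ?thesis
    unfolding C1sharp_def C1_differentiable_on_def
    using der by (auto simp: has_real_derivative_iff_has_vector_derivative intro!: exI[of _ "\<lambda>x. - D (- x)"])
qed

lemma is_interval_uminus_image: "is_interval I \<Longrightarrow> is_interval (uminus ` I :: real set)"
  by (simp add: is_interval_convex_1 convex_negations)

lemma qa_mean_reflect:
  assumes I: "is_interval I" and f: "f \<in> CM I" and v: "v \<noteq> []" "set v \<subseteq> I"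
  shows "qa_mean (uminus ` I) (\<lambda>x. f (- x)) (map uminus v) = - qa_mean I f v"
proof (rule qa_mean_eqI)
  have "continuous_on I f" using f by (simp add: CM_def)
  note m = qa_mean[OF I this v]
  show "inj_on (\<lambda>x. f (- x)) (uminus ` I)" using CM_inj_on[OF CM_reflect[OF f]] .
  show "- qa_mean I f v \<in> uminus ` I" using m(1) by simp
  show "f (- (- qa_mean I f v)) = (\<Sum>x\<leftarrow>map uminus v. f (- x)) / real (length (map uminus v))"
    using m(2) by (simp add: comp_def)
qed

text \<open>Reflecting the entries negates each mean and so reverses the order; this is why
  \<open>f\<close> and \<open>k\<close> change sides.\<close>

lemma qa_le_reflect:
  assumes I: "is_interval I" and f: "f \<in> CM I" and k: "k \<in> CM I"
  shows "qa_le (uminus ` I) (\<lambda>x. f (- x)) (\<lambda>x. k (- x)) \<longleftrightarrow> qa_le I k f"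
proof -
  have *: "(\<forall>v. v \<noteq> [] \<and> set v \<subseteq> uminus ` I \<longrightarrow> P v) \<longleftrightarrow> (\<forall>v. v \<noteq> [] \<and> set v \<subseteq> I \<longrightarrow> P (map uminus v))"
    for P :: "real list \<Rightarrow> bool"
  proof (intro iffI allI impI)
    fix v assume "\<forall>v. v \<noteq> [] \<and> set v \<subseteq> uminus ` I \<longrightarrow> P v" "v \<noteq> [] \<and> set v \<subseteq> I"
    moreover from this have "map uminus v \<noteq> [] \<and> set (map uminus v) \<subseteq> uminus ` I" by auto
    ultimately show "P (map uminus v)" by blast
  next
    fix v assume *: "\<forall>v. v \<noteq> [] \<and> set v \<subseteq> I \<longrightarrow> P (map uminus v)" and v: "v \<noteq> [] \<and> set v \<subseteq> uminus ` I"
    have "P (map uminus (map uminus v))" by (rule *[rule_format]) (use v in force)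
    then show "P v" by (simp add: comp_def)
  qed
  show ?thesis
    unfolding qa_le_def * using qa_mean_reflect[OF I f] qa_mean_reflect[OF I k] by simp
qed

lemma greatest_lower_bound:
  assumes nt: "nontrivial_interval I" and F: "F \<subseteq> C1sharp I" "F \<noteq> {}"
    and g: "g \<in> CM I" "\<forall>f\<in>F. qa_le I g f"
  shows "\<exists>l\<in>C1sharp I. (\<forall>f\<in>F. qa_le I l f) \<and> (\<forall>k\<in>CM I. (\<forall>f\<in>F. qa_le I k f) \<longrightarrow> qa_le I k l)"
proof -
  let ?I = "uminus ` I" and ?R = "\<lambda>f :: real \<Rightarrow> real. \<lambda>x. f (- x)"
  have I: "is_interval I" using nt by (simp add: nontrivial_interval_def)
  have nt': "nontrivial_interval ?I"
    using nt is_interval_uminus_image[OF I] by (force simp: nontrivial_interval_def)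
  have FCM: "f \<in> CM I" if "f \<in> F" for f using that F(1) C1sharp_subset_CM[OF nt] by blast
  have "?R ` F \<subseteq> C1sharp ?I" using F(1) C1sharp_reflect by blast
  moreover have "\<forall>h\<in>?R ` F. qa_le ?I h (?R g)"
    using g(2) qa_le_reflect[OF I FCM g(1)] by blast
  ultimately have "\<exists>u\<in>C1sharp ?I. (\<forall>h\<in>?R ` F. qa_le ?I h u) \<and>
      (\<forall>k\<in>CM ?I. (\<forall>h\<in>?R ` F. qa_le ?I h k) \<longrightarrow> qa_le ?I u k)"
    using F(2) CM_reflect[OF g(1)] by (intro least_upper_bound[OF nt', of _ "?R g"]) simp_all
  then obtain u where u: "u \<in> C1sharp ?I" "\<And>f. f \<in> F \<Longrightarrow> qa_le ?I (?R f) u"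
    and least: "\<And>k. k \<in> CM ?I \<Longrightarrow> (\<And>f. f \<in> F \<Longrightarrow> qa_le ?I (?R f) k) \<Longrightarrow> qa_le ?I u k"
    by (auto simp: ball_simps)
  have l: "?R u \<in> C1sharp I" using C1sharp_reflect[OF u(1)] by (simp add: image_image)
  then have lCM: "?R u \<in> CM I" using C1sharp_subset_CM[OF nt] by blast
  have "qa_le I (?R u) f" if "f \<in> F" for f
    using qa_le_reflect[OF I FCM[OF that] lCM] u(2)[OF that] by simp
  moreover have "qa_le I k (?R u)" if k: "k \<in> CM I" "\<forall>f\<in>F. qa_le I k f" for k
  proof -
    have "qa_le ?I u (?R k)"
      by (rule least) (use k CM_reflect qa_le_reflect[OF I FCM k(1)] in blast)+
    then show ?thesis using qa_le_reflect[OF I lCM k(1)] by simp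
  qed
  ultimately show ?thesis using l by blast
qed

text \<open>The family is taken to be nonempty: for empty \<open>F\<close> every element of
  \<open>CM I\<close> is an upper bound, and there is no least one, since the means generated by
  \<open>exp (- t * x)\<close> tend to the minimum of the entries as \<open>t\<close> grows.\<close>

theorem theorem3p3:
  fixes I :: "real set" and F :: "(real \<Rightarrow> real) set"
  assumes "nontrivial_interval I"
    and "F \<subseteq> C1sharp I"
    and "F \<noteq> {}"
  shows "((\<exists>g\<in>CM I. \<forall>f\<in>F. qa_le I f g) \<longrightarrow>
            (\<exists>u\<in>C1sharp I. (\<forall>f\<in>F. qa_le I f u) \<and>
               (\<forall>k\<in>CM I. (\<forall>f\<in>F. qa_le I f k) \<longrightarrow> qa_le I u k)))
       \<and> ((\<exists>g\<in>CM I. \<forall>f\<in>F. qa_le I g f) \<longrightarrow>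
            (\<exists>l\<in>C1sharp I. (\<forall>f\<in>F. qa_le I l f) \<and>
               (\<forall>k\<in>CM I. (\<forall>f\<in>F. qa_le I k f) \<longrightarrow> qa_le I k l)))"
  using least_upper_bound[OF assms] greatest_lower_bound[OF assms] by blast

end
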